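(* Let $q = 2^n$ for a positive integer $n$ such that $q-1$ is prime, and let $s$ be an integer with $2 \leq s \leq q-1$. Then there exists a linear $(2,s,q)$-AONT over $\mathbb{F}_q$, i.e., an invertible $s \times s$ matrix over $\mathbb{F}_q$ all of whose $2 \times 2$ submatrices are invertible.
   Context: For a prime power $q$ and integers $1 \le t \le s$, a linear $(t,s,q)$-all-or-nothing transform (AONT) is an invertible $s\times s$ matrix $M$ over the finite field $\mathbb{F}_q$ defining the bijection $\mathbf{y}\mapsto \mathbf{x}=\mathbf{y}M$ of $\mathbb{F}_q^s$ such that, for every set $I$ of $t$ input coordinates and every set $J$ of $t$ output coordinates, knowing the $s-t$ output values $y_j$, $j\notin J$, gives no information about the values $x_i$, $i \in I$. It is a known fact that an invertible $M$ is a linear $(t,s,q)$-AONT if and only if every $t\times t$ submatrix of $M$ is invertible. *)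

theory Defs
  imports
    "HOL-Probability.Probability_Mass_Function"
    "HOL-Computational_Algebra.Primes"
    "Jordan_Normal_Form.DL_Submatrix"
begin

text \<open>
  Inputs are \<open>x\<close>, outputs are \<open>y\<close>, and they are related by \<open>x = y M\<close> for row vectors, which is
  \<open>M\<^sup>T y\<close> for the column vectors of \<^typ>\<open>'a Matrix.vec\<close>. Coordinates are numbered from 0.
  The joint distribution below has uniformly distributed inputs: for invertible \<open>M\<close> every \<open>x\<close> lies
  in exactly one of the pairs.
\<close>

definition io_distr :: "nat \<Rightarrow> 'a :: {field, finite} mat \<Rightarrow> ('a Matrix.vec \<times> 'a Matrix.vec) pmf" where
  "io_distr s M =
     pmf_of_set {(x, y). x \<in> carrier_vec s \<and> y \<in> carrier_vec s \<and> x = transpose_mat M *\<^sub>v y}"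

definition coords :: "nat set \<Rightarrow> 'a Matrix.vec \<Rightarrow> nat \<Rightarrow> 'a" where
  "coords K v = restrict (vec_index v) K"

text \<open>
  The inputs in \<open>I\<close> have the same distribution after conditioning on any values \<open>w\<close> that the
  outputs in \<open>K\<close> can take. The condition on \<open>w\<close> excludes conditioning on a null event, where
  \<^const>\<open>cond_pmf\<close> is unspecified.
\<close>

definition outputs_give_no_information ::
    "nat \<Rightarrow> 'a :: {field, finite} mat \<Rightarrow> nat set \<Rightarrow> nat set \<Rightarrow> bool" where
  "outputs_give_no_information s M K I \<longleftrightarrow>
     (\<forall>w \<in> set_pmf (map_pmf (\<lambda>(x, y). coords K y) (io_distr s M)).
        map_pmf (\<lambda>(x, y). coords I x) (cond_pmf (io_distr s M) {(x, y). coords K y = w}) =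
        map_pmf (\<lambda>(x, y). coords I x) (io_distr s M))"

definition linear_AONT :: "nat \<Rightarrow> nat \<Rightarrow> nat \<Rightarrow> 'a :: {field, finite} mat \<Rightarrow> bool" where
  "linear_AONT t s q M \<longleftrightarrow>
     CARD('a) = q \<and> 1 \<le> t \<and> t \<le> s \<and> M \<in> carrier_mat s s \<and> invertible_mat M \<and>
     (\<forall>I J. I \<subseteq> {..<s} \<and> J \<subseteq> {..<s} \<and> card I = t \<and> card J = t \<longrightarrow>
        outputs_give_no_information s M ({..<s} - J) I)"

end

theory Submission
  imports Defs "Jordan_Normal_Form.Determinant"
begin

text \<open>
  Let \<open>p = q - 1\<close> and \<open>a \<notin> {0, 1}\<close>. Since \<open>a ^ p = 1\<close> and \<open>p\<close> is prime, \<open>a\<close> has order \<open>p\<close>. The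
  matrix \<open>M = (a ^ (i * j))\<close> with \<open>i, j < s \<le> p\<close> is a Vandermonde matrix with distinct nodes, hence
  invertible. The \<open>2 \<times> 2\<close> minor with rows \<open>i < i'\<close> and columns \<open>j < j'\<close> vanishes iff
  \<open>a ^ ((i' - i) * (j' - j)) = 1\<close>, that is, iff \<open>p\<close> divides \<open>(i' - i) * (j' - j)\<close>, which is impossible
  because both factors lie strictly between 0 and \<open>p\<close>.

  Invertibility of all \<open>t \<times> t\<close> submatrices makes \<open>y \<mapsto> (x\<^sub>I, y\<^sub>K)\<close> with \<open>K\<close> the complement of \<open>J\<close>
  injective, and then bijective by counting, so that \<open>x\<^sub>I\<close> and \<open>y\<^sub>K\<close> are independent.
\<close>

unbundle no vec_syntax

section \<open>Invertibility, kernels and submatrices\<close>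

lemma invertible_mat_iff_kernel:
  fixes A :: "'a :: field mat"
  assumes A: "A \<in> carrier_mat n n"
  shows "invertible_mat A \<longleftrightarrow> (\<forall>v \<in> carrier_vec n. A *\<^sub>v v = 0\<^sub>v n \<longrightarrow> v = 0\<^sub>v n)"
proof
  assume "invertible_mat A"
  then obtain B where AB: "A * B = 1\<^sub>m n" and BA: "B * A = 1\<^sub>m (dim_row B)"
    using A unfolding invertible_mat_def inverts_mat_def by auto
  \<comment> \<open>\<open>inverts_mat\<close> does not state the size of \<open>B\<close>;
    comparing column counts in the two equations recovers it.\<close>
  have B: "B \<in> carrier_mat n n"
    using A arg_cong[OF AB, of dim_col] arg_cong[OF BA, of dim_col] by auto
  show "\<forall>v \<in> carrier_vec n. A *\<^sub>v v = 0\<^sub>v n \<longrightarrow> v = 0\<^sub>v n"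
  proof (intro ballI impI)
    fix v :: "'a Matrix.vec"
    assume v: "v \<in> carrier_vec n" and "A *\<^sub>v v = 0\<^sub>v n"
    then have "B *\<^sub>v (A *\<^sub>v v) = 0\<^sub>v n"
      using B by auto
    moreover have "B *\<^sub>v (A *\<^sub>v v) = v"
      using assoc_mult_mat_vec[OF B A v, symmetric] BA B v by simp
    ultimately show "v = 0\<^sub>v n"
      by simp
  qed
next
  assume "\<forall>v \<in> carrier_vec n. A *\<^sub>v v = 0\<^sub>v n \<longrightarrow> v = 0\<^sub>v n"
  then have "Determinant.det A \<noteq> 0"
    using det_0_iff_vec_prod_zero_field[OF A] by blast
  from det_non_zero_imp_unit[OF A this, of "()"]
  obtain B where "B \<in> carrier_mat n n" "A * B = 1\<^sub>m n" "B * A = 1\<^sub>m n"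
    unfolding Units_def ring_mat_def by auto
  then show "invertible_mat A"
    using A unfolding invertible_mat_def inverts_mat_def by auto
qed

lemma invertible_mat_transpose:
  fixes A :: "'a :: field mat"
  assumes A: "A \<in> carrier_mat n n" and inv: "invertible_mat A"
  shows "invertible_mat (transpose_mat A)"
proof -
  have "Determinant.det A \<noteq> 0"
    using inv invertible_mat_iff_kernel[OF A] det_0_iff_vec_prod_zero_field[OF A] by blast
  then have "Determinant.det (transpose_mat A) \<noteq> 0"
    by (simp add: det_transpose[OF A])
  moreover have T: "transpose_mat A \<in> carrier_mat n n"
    using A by simp
  ultimately show ?thesis
    using invertible_mat_iff_kernel[OF T] det_0_iff_vec_prod_zero_field[OF T] by blast
qed

text \<open>\<open>pick S\<close> is strictly increasing below \<open>card S\<close>, hence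
  injective, and its image is a subset of \<open>S\<close> of full size. The bijection turns sums
  over submatrix indices into sums over \<open>S\<close>.\<close>

lemma bij_betw_pick:
  assumes "finite S"
  shows "bij_betw (pick S) {..<card S} S"
proof -
  have inj: "inj_on (pick S) {..<card S}"
    by (rule linorder_inj_onI) (auto dest: pick_mono_le)
  moreover have "pick S ` {..<card S} = S"
    by (rule card_subset_eq) (use assms inj in \<open>auto simp: card_image pick_in_set_le\<close>)
  ultimately show ?thesis
    by (simp add: bij_betw_def)
qed

lemma submatrix_carrier:
  assumes "A \<in> carrier_mat m n" "I \<subseteq> {..<m}" "J \<subseteq> {..<n}"
  shows "submatrix A I J \<in> carrier_mat (card I) (card J)"
    and "\<And>i j. i < card I \<Longrightarrow> j < card J \<Longrightarrow> submatrix A I J $$ (i, j) = A $$ (pick I i, pick J j)"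
proof -
  have "{i. i < dim_row A \<and> i \<in> I} = I" "{j. j < dim_col A \<and> j \<in> J} = J"
    using assms by auto
  then show "submatrix A I J \<in> carrier_mat (card I) (card J)"
    and "\<And>i j. i < card I \<Longrightarrow> j < card J \<Longrightarrow> submatrix A I J $$ (i, j) = A $$ (pick I i, pick J j)"
    by (simp_all add: submatrix_def)
qed

section \<open>Counting vectors, and independence from a product bijection\<close>

lemma bij_betw_vec: "bij_betw (vec n) ({..<n} \<rightarrow>\<^sub>E UNIV) (carrier_vec n)"
proof (rule bij_betwI[where g = "coords {..<n}"])
  show "coords {..<n} (vec n f) = f" if "f \<in> {..<n} \<rightarrow>\<^sub>E UNIV" for f :: "nat \<Rightarrow> 'a"
    using that by (auto simp: coords_def fun_eq_iff PiE_def extensional_def restrict_def)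
  show "vec n (coords {..<n} v) = v" if "v \<in> carrier_vec n" for v :: "'a Matrix.vec"
    using that by (auto simp: coords_def)
qed (auto simp: coords_def)

lemma
  shows finite_carrier_vec: "finite (carrier_vec n :: 'a :: finite Matrix.vec set)"
    and card_carrier_vec: "card (carrier_vec n :: 'a :: finite Matrix.vec set) = CARD('a) ^ n"
  using bij_betw_finite[OF bij_betw_vec[of n, where ?'a = 'a]]
    bij_betw_same_card[OF bij_betw_vec[of n, where ?'a = 'a]]
  by (simp_all add: finite_PiE card_funcsetE)

text \<open>Independence in counting form: under the bijection, each fibre of \<open>g\<close> over
  a point of \<open>B\<close> is a copy of \<open>A\<close> via \<open>f\<close>. Hence the law of
  \<open>f\<close> is uniform on \<open>A\<close> both before and after conditioning on a value of
  \<open>g\<close>.\<close>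

lemma
  assumes fin: "finite A" "finite B"
    and bij: "bij_betw (\<lambda>z. (f z, g z)) S (A \<times> B)"
    and ne: "S \<noteq> {}"
  shows map_pmf_of_set_fst_bij: "map_pmf f (pmf_of_set S) = pmf_of_set A"
    and map_cond_pmf_of_set_fst_bij: "w \<in> g ` S \<Longrightarrow>
      map_pmf f (cond_pmf (pmf_of_set S) {z. g z = w}) = pmf_of_set A"
proof -
  have finS: "finite S"
    using bij_betw_finite[OF bij] fin by simp
  have inj: "inj_on (\<lambda>z. (f z, g z)) S" and img: "(\<lambda>z. (f z, g z)) ` S = A \<times> B"
    using bij by (auto simp: bij_betw_def)
  have neA: "A \<noteq> {}" and neB: "B \<noteq> {}"
    using img ne by auto
  have fibre: "bij_betw f (S \<inter> {z. g z = w}) A" if w: "w \<in> B" for w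
  proof (rule bij_betw_imageI)
    show "inj_on f (S \<inter> {z. g z = w})"
      using inj by (auto simp: inj_on_def)
    show "f ` (S \<inter> {z. g z = w}) = A"
    proof (intro equalityI subsetI)
      fix x assume "x \<in> A"
      then have "(x, w) \<in> (\<lambda>z. (f z, g z)) ` S"
        using img w by simp
      then show "x \<in> f ` (S \<inter> {z. g z = w})"
        by auto
    qed (use img in auto)
  qed
  have "map_pmf f (pmf_of_set S) = map_pmf fst (map_pmf (\<lambda>z. (f z, g z)) (pmf_of_set S))"
    by (simp add: pmf.map_comp o_def)
  also have "map_pmf (\<lambda>z. (f z, g z)) (pmf_of_set S) = pmf_of_set (A \<times> B)"
    by (rule map_pmf_of_set_bij_betw[OF bij ne finS])
  also have "map_pmf fst (pmf_of_set (A \<times> B)) = pmf_of_set A"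
  proof -
    have "pmf_of_set (A \<times> B) = pair_pmf (pmf_of_set A) (pmf_of_set B)"
    proof (rule pmf_eqI)
      show "pmf (pmf_of_set (A \<times> B)) z = pmf (pair_pmf (pmf_of_set A) (pmf_of_set B)) z" for z
        by (cases z)
          (use fin neA neB in \<open>simp add: pmf_pair card_cartesian_product indicator_times\<close>)
    qed
    then show ?thesis
      by (simp add: map_fst_pair_pmf)
  qed
  finally show "map_pmf f (pmf_of_set S) = pmf_of_set A" .
  show "map_pmf f (cond_pmf (pmf_of_set S) {z. g z = w}) = pmf_of_set A" if "w \<in> g ` S"
  proof -
    have w: "w \<in> B"
      using that img by auto
    have ne': "S \<inter> {z. g z = w} \<noteq> {}"
      using that by auto
    \<comment> \<open>Conditioning a uniform distribution on an event that meets its support gives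
      the uniform distribution on the intersection.\<close>
    have "cond_pmf (pmf_of_set S) {z. g z = w} = pmf_of_set (S \<inter> {z. g z = w})"
    proof (rule pmf_eqI)
      fix z
      have "set_pmf (pmf_of_set S) \<inter> {z. g z = w} \<noteq> {}"
        using finS ne ne' by simp
      then show "pmf (cond_pmf (pmf_of_set S) {z. g z = w}) z = pmf (pmf_of_set (S \<inter> {z. g z = w})) z"
        using finS ne ne'
        by (auto simp: pmf_cond measure_pmf_of_set indicator_def)
    qed
    then show ?thesis
      using map_pmf_of_set_bij_betw[OF fibre[OF w] ne'] finS by simp
  qed
qed

section \<open>From invertible submatrices to the AONT property\<close>

lemma coords_eq_iff: "coords K v = coords K w \<longleftrightarrow> (\<forall>k \<in> K. vec_index v k = vec_index w k)"
  by (auto simp: coords_def fun_eq_iff restrict_def)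

text \<open>The difference of two output vectors with equal images is supported on \<open>J\<close>.
  Equality of the inputs in \<open>I\<close> then says that the transposed submatrix annihilates
  this difference, which is therefore zero.\<close>

lemma inj_on_inputs_outputs:
  fixes M :: "'a :: field mat"
  assumes M: "M \<in> carrier_mat s s" and IJ: "I \<subseteq> {..<s}" "J \<subseteq> {..<s}" "card I = card J"
    and inv: "invertible_mat (submatrix M J I)"
  shows "inj_on (\<lambda>y. (coords I (transpose_mat M *\<^sub>v y), coords ({..<s} - J) y)) (carrier_vec s)"
proof (rule inj_onI)
  fix y z :: "'a Matrix.vec"
  assume y: "y \<in> carrier_vec s" and z: "z \<in> carrier_vec s"
    and eq: "(coords I (transpose_mat M *\<^sub>v y), coords ({..<s} - J) y) =
      (coords I (transpose_mat M *\<^sub>v z), coords ({..<s} - J) z)"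
  define t where "t = card J"
  define d where "d j = y $ j - z $ j" for j
  define v where "v = vec t (\<lambda>k. d (pick J k))"
  have finJ: "finite J"
    using IJ finite_subset by blast
  have dK: "d j = 0" if "j < s" "j \<notin> J" for j
    using eq that by (auto simp: coords_eq_iff d_def)
  let ?N = "transpose_mat (submatrix M J I)"
  have sub: "submatrix M J I \<in> carrier_mat t t"
    and sub_index: "\<And>k l. k < t \<Longrightarrow> l < t \<Longrightarrow> submatrix M J I $$ (k, l) = M $$ (pick J k, pick I l)"
    using submatrix_carrier[OF M IJ(2,1)] IJ(3) by (simp_all add: t_def)
  have N: "?N \<in> carrier_mat t t"
    using sub by simp
  have "?N *\<^sub>v v = 0\<^sub>v t"
  proof (rule eq_vecI)
    fix l assume "l < dim_vec (0\<^sub>v t)"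
    then have l: "l < t" by simp
    define i where "i = pick I l"
    have iI: "i \<in> I"
      using l IJ(3) by (simp add: i_def t_def pick_in_set_le)
    then have i: "i < s"
      using IJ by auto
    \<comment> \<open>The entry becomes a sum over \<open>J\<close> through \<open>pick\<close>,
      then over all outputs because \<open>d\<close> vanishes off \<open>J\<close>; that is the
      difference of the two inputs at \<open>i\<close>.\<close>
    have "(?N *\<^sub>v v) $ l = (\<Sum>k<t. M $$ (pick J k, i) * d (pick J k))"
      using l N sub sub_index
      by (auto simp: scalar_prod_def v_def i_def lessThan_atLeast0 intro!: sum.cong)
    also have "\<dots> = (\<Sum>j\<in>J. M $$ (j, i) * d j)"
      unfolding t_def by (rule sum.reindex_bij_betw[OF bij_betw_pick[OF finJ]])
    also have "\<dots> = (\<Sum>j<s. M $$ (j, i) * d j)"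
      by (rule sum.mono_neutral_left) (use IJ dK in auto)
    also have "\<dots> = (transpose_mat M *\<^sub>v y) $ i - (transpose_mat M *\<^sub>v z) $ i"
      using M y z i
      by (simp add: scalar_prod_def d_def lessThan_atLeast0 sum_subtractf algebra_simps)
    also have "\<dots> = 0"
      using eq iI by (auto simp: coords_eq_iff)
    finally show "(?N *\<^sub>v v) $ l = 0\<^sub>v t $ l"
      using l by simp
  qed (use sub in simp)
  moreover have "v \<in> carrier_vec t"
    by (simp add: v_def)
  ultimately have v0: "v = 0\<^sub>v t"
    using invertible_mat_transpose[OF sub inv] invertible_mat_iff_kernel[OF N] by blast
  have "d j = 0" if "j \<in> J" for j
  proof -
    have "j \<in> pick J ` {..<t}"
      using that bij_betw_imp_surj_on[OF bij_betw_pick[OF finJ]] by (simp add: t_def)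
    then obtain k where "k < t" "j = pick J k"
      by auto
    then show ?thesis
      using arg_cong[OF v0, of "\<lambda>u. u $ k"] by (simp add: v_def)
  qed
  with dK have "d j = 0" if "j < s" for j
    using that by blast
  then show "y = z"
    using y z by (auto simp: d_def)
qed

text \<open>Since \<open>card I + card K = s\<close>, the pairs of values on \<open>I\<close> and
  \<open>K\<close> are as numerous as the output vectors, so the injective map \<open>?F\<close> is
  a bijection onto a product, and the independence lemma applies.\<close>

lemma linear_AONT_if_submatrices_invertible:
  fixes M :: "'a :: {field, finite} mat"
  assumes M: "M \<in> carrier_mat s s" "invertible_mat M" and t: "1 \<le> t" "t \<le> s"
    and inv: "\<And>I J. \<lbrakk>I \<subseteq> {..<s}; J \<subseteq> {..<s}; card I = t; card J = t\<rbrakk> \<Longrightarrow>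
      invertible_mat (submatrix M I J)"
  shows "linear_AONT t s CARD('a) M"
  unfolding linear_AONT_def
proof (intro conjI allI impI; (elim conjE)?)
  fix I J :: "nat set"
  assume IJ: "I \<subseteq> {..<s}" "J \<subseteq> {..<s}" "card I = t" "card J = t"
  define K where "K = {..<s} - J"
  define S where "S = {(x, y). x \<in> carrier_vec s \<and> y \<in> carrier_vec s \<and> x = transpose_mat M *\<^sub>v y}"
  define A B :: "(nat \<Rightarrow> 'a) set" where "A = I \<rightarrow>\<^sub>E UNIV" and "B = K \<rightarrow>\<^sub>E UNIV"
  let ?f = "\<lambda>(x :: 'a Matrix.vec, y :: 'a Matrix.vec). coords I x"
  let ?g = "\<lambda>(x :: 'a Matrix.vec, y :: 'a Matrix.vec). coords K y"
  let ?h = "\<lambda>y. (transpose_mat M *\<^sub>v y, y)"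
  let ?F = "\<lambda>y. (coords I (transpose_mat M *\<^sub>v y), coords K y)"
  have fin: "finite I" "finite J" "finite K"
    using IJ finite_subset unfolding K_def by blast+
  have finAB: "finite A" "finite B"
    using fin by (auto simp: A_def B_def finite_PiE)
  have "card (A \<times> B) = CARD('a) ^ (card I + card K)"
    using fin by (simp add: A_def B_def card_cartesian_product card_funcsetE power_add)
  also have "card I + card K = s"
    using IJ fin t by (simp add: K_def card_Diff_subset)
  finally have card: "card (A \<times> B) = CARD('a) ^ s" .
  have inj: "inj_on ?F (carrier_vec s)"
    \<comment> \<open>Rows of \<open>M\<close> belong to outputs and columns to inputs, so the
      hypothesis \<open>inv\<close> is applied with \<open>J\<close> as row set and \<open>I\<close>
      as column set.\<close>
    using inj_on_inputs_outputs[OF M(1) IJ(1,2)] inv[OF IJ(2,1)] IJ unfolding K_def by simp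
  moreover have "?F ` carrier_vec s = A \<times> B"
    by (rule card_subset_eq)
      (use finAB inj card in \<open>auto simp: card_image card_carrier_vec A_def B_def coords_def\<close>)
  ultimately have F: "bij_betw ?F (carrier_vec s) (A \<times> B)"
    by (simp add: bij_betw_def)
  \<comment> \<open>\<open>S\<close> is parametrized by the outputs alone, so the bijection
    \<open>?F\<close> carries over to input-output pairs.\<close>
  have S_img: "S = ?h ` carrier_vec s"
    using M by (auto simp: S_def)
  have "bij_betw (\<lambda>z. (?f z, ?g z)) S (A \<times> B)"
    using F unfolding bij_betw_def S_img by (auto simp: inj_on_def image_image)
  moreover have neS: "S \<noteq> {}"
    using zero_carrier_vec[of s, where ?'a = 'a] unfolding S_img by blast
  ultimately have uncond: "map_pmf ?f (pmf_of_set S) = pmf_of_set A"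
    and cond: "\<And>w. w \<in> ?g ` S \<Longrightarrow> map_pmf ?f (cond_pmf (pmf_of_set S) {z. ?g z = w}) = pmf_of_set A"
    using map_pmf_of_set_fst_bij[OF finAB] map_cond_pmf_of_set_fst_bij[OF finAB] by blast+
  have finS: "finite S"
    by (simp add: S_img finite_carrier_vec)
  have set_eq: "{(x, y). coords K y = w} = {z. ?g z = w}" for w :: "nat \<Rightarrow> 'a"
    by auto
  show "outputs_give_no_information s M ({..<s} - J) I"
    unfolding outputs_give_no_information_def io_distr_def S_def[symmetric] K_def[symmetric]
  proof
    fix w assume "w \<in> set_pmf (map_pmf ?g (pmf_of_set S))"
    then have "w \<in> ?g ` S"
      unfolding set_map_pmf set_pmf_of_set[OF neS finS] .
    then show "map_pmf ?f (cond_pmf (pmf_of_set S) {(x, y). coords K y = w}) =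
        map_pmf ?f (pmf_of_set S)"
      unfolding uncond set_eq by (rule cond)
  qed
qed (use assms in auto)

section \<open>Powers in finite fields, and two invertibility criteria\<close>

text \<open>Multiplication by \<open>a\<close> permutes the nonzero elements. Comparing their
  product before and after, and cancelling it, leaves the claim.\<close>

lemma finite_field_power_card_minus_1:
  fixes a :: "'a :: {field, finite}"
  assumes "a \<noteq> 0"
  shows "a ^ (CARD('a) - 1) = 1"
proof -
  let ?U = "UNIV - {0 :: 'a}"
  have "bij_betw ((*) a) ?U ?U"
    by (rule bij_betwI[where g = "\<lambda>x. x / a"]) (use assms in auto)
  then have "(\<Prod>x\<in>?U. a * x) = \<Prod>?U"
    by (rule prod.reindex_bij_betw)
  then have "a ^ card ?U * \<Prod>?U = \<Prod>?U"
    by (simp add: prod.distrib)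
  moreover have "\<Prod>?U \<noteq> 0"
    by simp
  ultimately show ?thesis
    by simp
qed

lemma power_eq_1_coprime:
  fixes a :: "'a :: monoid_mult"
  assumes "a ^ m = 1" "a ^ n = 1" "coprime m n"
  shows "a = 1"
proof (cases "m = 0")
  case True
  then show ?thesis
    using assms by simp
next
  case False
  \<comment> \<open>Bezout over the naturals, with no negative exponents, requires \<open>m\<close>
    to be nonzero; for \<open>m = 0\<close> coprimality forces \<open>n = 1\<close>.\<close>
  then obtain x y where "m * x = n * y + 1"
    using bezout_nat[of m n] assms(3) by auto
  then have "a ^ (m * x) = a ^ (n * y) * a"
    by (simp add: power_add power_commutes)
  then show ?thesis
    using assms by (simp add: power_mult)
qed

text \<open>A kernel vector is the coefficient list of a polynomial of degree below \<open>n\<close>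
  with the \<open>n\<close> distinct roots \<open>c i\<close>, so it is zero.\<close>

lemma invertible_Vandermonde:
  fixes c :: "nat \<Rightarrow> 'a :: field"
  assumes "inj_on c {..<n}"
  shows "invertible_mat (mat n n (\<lambda>(i, j). c i ^ j))"
proof -
  let ?V = "mat n n (\<lambda>(i, j). c i ^ j)"
  have "v = 0\<^sub>v n" if v: "v \<in> carrier_vec n" and Vv: "?V *\<^sub>v v = 0\<^sub>v n" for v
  proof -
    define f where "f = (\<Sum>j<n. monom (v $ j) j)"
    have coeff: "coeff f j = (if j < n then v $ j else 0)" for j
      by (simp add: f_def coeff_sum)
    have root: "poly f (c i) = 0" if i: "i < n" for i
    proof -
      have "poly f (c i) = (?V *\<^sub>v v) $ i"
        using v i by (simp add: f_def poly_sum poly_monom scalar_prod_def lessThan_atLeast0 mult.commute)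
      then show ?thesis
        using Vv i by simp
    qed
    have "f = 0"
    proof (rule ccontr)
      assume f: "f \<noteq> 0"
      then have "degree f < n"
        using coeff[of "degree f"] by (auto split: if_splits)
      moreover have "card (c ` {..<n}) \<le> card {x. poly f x = 0}"
        by (rule card_mono) (use root poly_roots_finite[OF f] in auto)
      moreover have "card {x. poly f x = 0} \<le> degree f"
        using f by (rule card_poly_roots_bound)
      ultimately show False
        using assms by (simp add: card_image)
    qed
    then show ?thesis
      using v coeff by (intro eq_vecI) (auto, metis coeff_0)
  qed
  then show ?thesis
    by (subst invertible_mat_iff_kernel[of _ n]) auto
qed

text \<open>Multiplying \<open>A v = 0\<close> by the adjugate gives the determinant times each
  coordinate of \<open>v\<close>, so the kernel is trivial.\<close>

lemma invertible_mat_2: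
  fixes A :: "'a :: field mat"
  assumes A: "A \<in> carrier_mat 2 2" and det: "A $$ (0, 0) * A $$ (1, 1) \<noteq> A $$ (0, 1) * A $$ (1, 0)"
  shows "invertible_mat A"
proof -
  have "v = 0\<^sub>v 2" if v: "v \<in> carrier_vec 2" and Av: "A *\<^sub>v v = 0\<^sub>v 2" for v
  proof -
    have one_less_two: "1 < (2 :: nat)"
      by simp
    have eqs: "A $$ (i, 0) * v $ 0 + A $$ (i, 1) * v $ 1 = 0" if "i < 2" for i
      using arg_cong[OF Av, of "\<lambda>u. u $ i"] A v that
      by (simp add: scalar_prod_def numeral_2_eq_2)
    let ?D = "A $$ (0, 0) * A $$ (1, 1) - A $$ (0, 1) * A $$ (1, 0)"
    have "?D * v $ 0 = A $$ (1, 1) * (A $$ (0, 0) * v $ 0 + A $$ (0, 1) * v $ 1)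
        - A $$ (0, 1) * (A $$ (1, 0) * v $ 0 + A $$ (1, 1) * v $ 1)"
      "?D * v $ 1 = A $$ (0, 0) * (A $$ (1, 0) * v $ 0 + A $$ (1, 1) * v $ 1)
        - A $$ (1, 0) * (A $$ (0, 0) * v $ 0 + A $$ (0, 1) * v $ 1)"
      by (simp_all only: algebra_simps)
    then have "?D * v $ 0 = 0" "?D * v $ 1 = 0"
      by (simp_all only: eqs[OF pos2] eqs[OF one_less_two] mult_zero_right diff_self)
    then have "v $ 0 = 0" "v $ 1 = 0"
      using det by simp_all
    then show ?thesis
      using v by (intro eq_vecI) (auto simp: less_2_cases_iff)
  qed
  then show ?thesis
    by (subst invertible_mat_iff_kernel[OF A]) auto
qed

theorem theorem8:
  fixes n q s :: nat
  assumes "n > 0"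
    and "q = 2 ^ n"
    and "CARD('a :: {field, finite}) = q"
    and "prime (q - 1)"
    and "2 \<le> s"
    and "s \<le> q - 1"
  shows "\<exists>M :: 'a mat.
      linear_AONT 2 s q M \<and>
      M \<in> carrier_mat s s \<and> invertible_mat M \<and>
      (\<forall>I J. I \<subseteq> {..<s} \<and> J \<subseteq> {..<s} \<and> card I = 2 \<and> card J = 2 \<longrightarrow>
        invertible_mat (submatrix M I J))"
proof -
  define p where "p = q - 1"
  have p: "prime p" "s \<le> p"
    using assms by (auto simp: p_def)
  \<comment> \<open>The bounds on \<open>s\<close> give \<open>q \<ge> 3\<close>, which leaves room
    for an element other than 0 and 1.\<close>
  have "card {0, 1 :: 'a} < CARD('a)"
    using assms by simp
  then have "{0, 1 :: 'a} \<noteq> UNIV"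
    by (metis less_irrefl)
  then obtain a :: 'a where a: "a \<noteq> 0" "a \<noteq> 1"
    by auto
  have ap: "a ^ p = 1"
    using finite_field_power_card_minus_1[OF a(1)] assms by (simp add: p_def)
  have coprime: "coprime d p" if "0 < d" "d < p" for d
    using that p(1) by (metis coprime_commute dvd_imp_le leD prime_imp_coprime)
  have order: "a ^ d \<noteq> 1" if "coprime d p" for d
    using power_eq_1_coprime[OF _ ap that] a by blast
  define M where "M = mat s s (\<lambda>(i, j). (a ^ i) ^ j)"
  have M: "M \<in> carrier_mat s s"
    by (simp add: M_def)
  have "inj_on (\<lambda>i. a ^ i) {..<s}"
  proof (rule linorder_inj_onI)
    fix i j assume ij: "i < j" "i \<in> {..<s}" "j \<in> {..<s}"
    have "a ^ j = a ^ i * a ^ (j - i)"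
      using ij by (simp flip: power_add)
    moreover have "a ^ (j - i) \<noteq> 1"
      by (rule order[OF coprime]) (use ij p in auto)
    ultimately show "a ^ i \<noteq> a ^ j"
      using a by auto
  qed auto
  then have inv: "invertible_mat M"
    unfolding M_def by (rule invertible_Vandermonde)
  have sub: "invertible_mat (submatrix M I J)"
    if IJ: "I \<subseteq> {..<s}" "J \<subseteq> {..<s}" "card I = 2" "card J = 2" for I J
  proof (rule invertible_mat_2)
    show "submatrix M I J \<in> carrier_mat 2 2"
      using submatrix_carrier(1)[OF M IJ(1,2)] IJ by simp
    \<comment> \<open>With rows \<open>i\<close>, \<open>i + d\<close> and columns \<open>j\<close>,
      \<open>j + e\<close>, the exponents in the two products of the minor differ by exactly
      \<open>d * e\<close>.\<close>
    define i j d e where "i = pick I 0" and "j = pick J 0"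
      and "d = pick I 1 - pick I 0" and "e = pick J 1 - pick J 0"
    have "pick I 0 < pick I 1" "pick J 0 < pick J 1"
      using IJ pick_mono_le[of 1 I 0] pick_mono_le[of 1 J 0] by (simp_all del: pick.simps One_nat_def)
    moreover have "pick I k < s" "pick J k < s" if "k < 2" for k
      using IJ pick_in_set_le[of k I] pick_in_set_le[of k J] that by auto
    ultimately have
      I: "pick I 0 = i" "pick I 1 = i + d" "i < s" "i + d < s" "0 < d" and
      J: "pick J 0 = j" "pick J 1 = j + e" "j < s" "j + e < s" "0 < e"
      by (simp_all add: i_def j_def d_def e_def del: pick.simps One_nat_def)
    \<comment> \<open>Both \<open>d\<close> and \<open>e\<close> are positive and below
      \<open>s \<le> p\<close>, so each is coprime to the prime \<open>p\<close>.\<close>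
    have "coprime (d * e) p"
      using coprime[of d] coprime[of e] I J p by simp
    then have "a ^ (d * e) \<noteq> 1"
      by (rule order)
    moreover have "(a ^ i) ^ j * (a ^ (i + d)) ^ (j + e) =
        (a ^ i) ^ (j + e) * (a ^ (i + d)) ^ j * a ^ (d * e)"
      by (simp add: algebra_simps flip: power_mult power_add)
    ultimately have "(a ^ i) ^ j * (a ^ (i + d)) ^ (j + e) \<noteq> (a ^ i) ^ (j + e) * (a ^ (i + d)) ^ j"
      using a by auto
    then show "submatrix M I J $$ (0, 0) * submatrix M I J $$ (1, 1) \<noteq>
        submatrix M I J $$ (0, 1) * submatrix M I J $$ (1, 0)"
      using submatrix_carrier(2)[OF M IJ(1,2)] IJ I J by (simp add: M_def del: pick.simps One_nat_def)
  qed
  have "linear_AONT 2 s q M"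
    using linear_AONT_if_submatrices_invertible[OF M inv _ _ sub] assms by simp
  with M inv sub show ?thesis
    by blast
qed

end
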